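(* Let $p\ge 3$ be an integer. Let $P_m^p(t)=\mathbb E_\lambda[t^{\phi^{(m)}(x)}]$ be the polynomials defined in the context, let $D_m^p=\deg P_m^p$, and let $S_m=D_{m+1}^p-D_m^p$ for $m\ge 0$. Let $\{\hat S_j\}_{j\ge0}$ be the substitution sequence defined in the context. Then $S_j=\hat S_j$ for every $j\ge 0$.
   Context: Polynomials. Let $p\ge 3$ be an integer (not necessarily prime). $\Gamma=\{x=(x_0,x_1,x_2,\ldots): x_k\in\{0,1,\ldots,p-1\}\}$ is the compact group of $p$-adic integers (addition with carry to the right), and $\lambda$ is its Haar probability measure; under $\lambda$ the coordinates are i.i.d. uniform on $\{0,\ldots,p-1\}$. $\Gamma'=\Gamma\setminus\{(p-1,p-1,\ldots)\}$. Let $S:x\mapsto x+1$ with $1=(1,0,0,\ldots)$ (not to be confused with the numbers $S_m$). For $x\in\Gamma'$, $\phi(x)$ is the first coordinate of $x$ different from $p-1$. Put $\phi^{(0)}=0$ and $\phi^{(m)}(x)=\phi(x)+\phi(Sx)+\cdots+\phi(S^{m-1}x)$ for $m\ge1$ (defined $\lambda$-a.e.). Put $P_m^p(t)=\mathbb E_\lambda[t^{\phi^{(m)}(x)}]=\sum_j \lambda(\phi^{(m)}=j)\,t^j$, a polynomial in $t$. Substitution sequence. Consider the substitution replacing each $q\in\{0,\ldots,p-2\}$ by the word of length $p$ that lists $p-2,p-3,\ldots,1,0$ in decreasing order with $q$ taken twice in a row (e.g. $0\mapsto p-2,\ldots,1,0,0$ and $p-2\mapsto p-2,p-2,p-3,\ldots,0$).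 Let $\{\hat S^{(0)}_j\}_{0\le j\le p-1}$ be the word $p-2,p-2,p-3,\ldots,1,0$, and let $\{\hat S^{(l+1)}_j\}_{0\le j<p^{l+2}}$ be obtained from $\{\hat S^{(l)}_j\}_{0\le j<p^{l+1}}$ by applying the substitution to every entry. Each $\{\hat S^{(l)}_j\}$ is a prefix of $\{\hat S^{(l+1)}_j\}$, and $\{\hat S_j\}_{j\ge0}$ is the infinite sequence having all of them as prefixes. *)

theory Defs
  imports "HOL-Probability.Probability" "HOL-Computational_Algebra.Polynomial"
    "HOL-Library.Sublist"
begin

section \<open>The \<open>p\<close>-adic integers and the odometer\<close>

definition padic :: "nat \<Rightarrow> (nat \<Rightarrow> nat) set" where
  "padic p = {x. \<forall>k. x k < p}"

text \<open>
  The normalised Haar measure of \<open>padic p\<close> is the law that makes the coordinates independent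
  and uniform on \<open>{0, \<dots>, p - 1}\<close>.
\<close>

definition haar :: "nat \<Rightarrow> (nat \<Rightarrow> nat) measure" where
  "haar p = (\<Pi>\<^sub>M k\<in>UNIV. uniform_count_measure {..<p})"

primrec carry :: "nat \<Rightarrow> (nat \<Rightarrow> nat) \<Rightarrow> (nat \<Rightarrow> nat) \<Rightarrow> nat \<Rightarrow> nat" where
  "carry p x y 0 = 0"
| "carry p x y (Suc k) = (x k + y k + carry p x y k) div p"

definition add_carry :: "nat \<Rightarrow> (nat \<Rightarrow> nat) \<Rightarrow> (nat \<Rightarrow> nat) \<Rightarrow> nat \<Rightarrow> nat" where
  "add_carry p x y = (\<lambda>k. (x k + y k + carry p x y k) mod p)"

definition padic_one :: "nat \<Rightarrow> nat" where
  "padic_one = (\<lambda>k. if k = 0 then 1 else 0)"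

definition odometer :: "nat \<Rightarrow> (nat \<Rightarrow> nat) \<Rightarrow> (nat \<Rightarrow> nat)" where
  "odometer p x = add_carry p x padic_one"

text \<open>
  \<open>phi p\<close> is meant on \<open>padic p - {\<lambda>_. p - 1}\<close>. At the excluded point the value is that of an
  arbitrary coordinate, hence \<open>p - 1\<close>; that point and its preimages under the iterates of the
  odometer are null sets, so the laws below do not depend on this choice.
\<close>

definition phi :: "nat \<Rightarrow> (nat \<Rightarrow> nat) \<Rightarrow> nat" where
  "phi p x = x (LEAST k. x k \<noteq> p - 1)"

definition phi_sum :: "nat \<Rightarrow> nat \<Rightarrow> (nat \<Rightarrow> nat) \<Rightarrow> nat" where
  "phi_sum p m x = (\<Sum>i<m. phi p ((odometer p ^^ i) x))"


section \<open>The generating polynomials\<close>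

text \<open>
  Since \<open>phi p x \<le> p - 1\<close> for \<open>x \<in> padic p\<close>, the range of summation covers all values of
  \<open>phi_sum p m\<close>; see \<open>poly_P_poly\<close> below for the identity with the expectation.
\<close>

definition P_poly :: "nat \<Rightarrow> nat \<Rightarrow> real poly" where
  "P_poly p m = (\<Sum>j\<le>m * (p - 1). monom (measure (haar p) {x \<in> padic p. phi_sum p m x = j}) j)"

definition P_deg :: "nat \<Rightarrow> nat \<Rightarrow> nat" where
  "P_deg p m = degree (P_poly p m)"

definition S_seq :: "nat \<Rightarrow> nat \<Rightarrow> int" where
  "S_seq p m = int (P_deg p (m + 1)) - int (P_deg p m)"


section \<open>The substitution sequence\<close>

definition subst_word :: "nat \<Rightarrow> nat \<Rightarrow> nat list" where
  "subst_word p q = concat (map (\<lambda>i. if i = q then [i, i] else [i]) (rev [0..<p - 1]))"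

primrec S_hat_word :: "nat \<Rightarrow> nat \<Rightarrow> nat list" where
  "S_hat_word p 0 = (p - 2) # rev [0..<p - 1]"
| "S_hat_word p (Suc l) = concat (map (subst_word p) (S_hat_word p l))"

text \<open>
  The word with index \<open>j\<close> has length \<open>p ^ (j + 1) > j\<close>. By \<open>S_hat_prefix\<close> below this is the
  infinite sequence that has all the words as prefixes.
\<close>

definition S_hat :: "nat \<Rightarrow> nat \<Rightarrow> nat" where
  "S_hat p j = S_hat_word p j ! j"


section \<open>Consistency of the definitions\<close>

lemma space_haar: "space (haar p) = padic p"
  by (auto simp: haar_def padic_def space_PiM space_uniform_count_measure PiE_def)

lemma prob_space_haar:
  assumes "p \<ge> 1" shows "prob_space (haar p)"
  unfolding haar_def
  by (rule prob_space_PiM, rule prob_space_uniform_count_measure) (use assms in \<open>auto simp: lessThan_empty_iff\<close>)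

lemma measurable_coord [measurable]: "(\<lambda>x. x k) \<in> haar p \<rightarrow>\<^sub>M count_space UNIV"
proof -
  have "(\<lambda>x. x k) \<in> haar p \<rightarrow>\<^sub>M uniform_count_measure {..<p}"
    unfolding haar_def by (rule measurable_component_singleton) simp
  moreover have "(\<lambda>i. i) \<in> uniform_count_measure {..<p} \<rightarrow>\<^sub>M count_space UNIV"
    by (auto simp: measurable_def space_uniform_count_measure sets_uniform_count_measure)
  ultimately show ?thesis
    by (rule measurable_compose)
qed

lemma measurable_count_space_binop:
  fixes f g :: "'a \<Rightarrow> nat" and h :: "nat \<Rightarrow> nat \<Rightarrow> nat"
  assumes f: "f \<in> M \<rightarrow>\<^sub>M count_space UNIV" and g: "g \<in> M \<rightarrow>\<^sub>M count_space UNIV"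
  shows "(\<lambda>x. h (f x) (g x)) \<in> M \<rightarrow>\<^sub>M count_space UNIV"
proof (rule measurable_compose_countable[OF _ f])
  show "(\<lambda>x. h i (g x)) \<in> M \<rightarrow>\<^sub>M count_space UNIV" for i
    by (rule measurable_compose[OF g]) simp
qed

lemma measurable_carry [measurable]:
  "(\<lambda>x. carry p x y k) \<in> haar p \<rightarrow>\<^sub>M count_space UNIV"
proof (induction k)
  case (Suc k)
  show ?case
    using measurable_count_space_binop[OF measurable_coord Suc, where h = "\<lambda>a c. (a + y k + c) div p"]
    by simp
qed simp

lemma odometer_in_padic: "p \<ge> 1 \<Longrightarrow> odometer p x \<in> padic p"
  by (simp add: odometer_def add_carry_def padic_def)

lemma odometer_pow_in_padic: "p \<ge> 1 \<Longrightarrow> x \<in> padic p \<Longrightarrow> (odometer p ^^ i) x \<in> padic p"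
  by (induction i) (auto simp: odometer_in_padic)

lemma measurable_odometer [measurable]:
  assumes "p \<ge> 1"
  shows "odometer p \<in> haar p \<rightarrow>\<^sub>M haar p"
proof -
  have "(\<lambda>x. \<lambda>k\<in>UNIV. odometer p x k) \<in> haar p \<rightarrow>\<^sub>M (\<Pi>\<^sub>M k\<in>UNIV. uniform_count_measure {..<p})"
  proof (rule measurable_restrict)
    fix k
    have *: "(\<lambda>x. odometer p x k) \<in> haar p \<rightarrow>\<^sub>M count_space UNIV"
      unfolding odometer_def add_carry_def
      using measurable_count_space_binop[OF measurable_coord measurable_carry,
        where h = "\<lambda>a c. (a + padic_one k + c) mod p"]
      by simp
    have "(\<lambda>x. odometer p x k) \<in> haar p \<rightarrow>\<^sub>M count_space {..<p}"
      using odometer_in_padic[OF assms] measurable_sets[OF *]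
      by (intro measurableI) (auto simp: padic_def)
    also have "haar p \<rightarrow>\<^sub>M count_space {..<p} = haar p \<rightarrow>\<^sub>M uniform_count_measure {..<p}"
      by (rule measurable_cong_sets) (auto simp: sets_uniform_count_measure)
    finally show "(\<lambda>x. odometer p x k) \<in> haar p \<rightarrow>\<^sub>M uniform_count_measure {..<p}" .
  qed
  then show ?thesis
    by (simp add: haar_def restrict_def)
qed

lemma measurable_phi [measurable]: "phi p \<in> haar p \<rightarrow>\<^sub>M count_space UNIV"
proof -
  have "Measurable.pred (haar p) (\<lambda>x. x k \<noteq> p - 1)" for k
    by (rule measurable_compose[OF measurable_coord]) simp
  then have L: "(\<lambda>x. LEAST k. x k \<noteq> p - 1) \<in> haar p \<rightarrow>\<^sub>M count_space UNIV"
    by (rule measurable_Least)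
  have "(\<lambda>x. x (LEAST k. x k \<noteq> p - 1)) \<in> haar p \<rightarrow>\<^sub>M count_space UNIV"
    by (rule measurable_compose_countable[where f = "\<lambda>k x. x k", OF measurable_coord L])
  then show ?thesis
    by (simp add: phi_def[abs_def])
qed

lemma measurable_phi_sum [measurable]:
  assumes "p \<ge> 1"
  shows "phi_sum p m \<in> haar p \<rightarrow>\<^sub>M count_space UNIV"
proof -
  have "odometer p ^^ i \<in> haar p \<rightarrow>\<^sub>M haar p" for i
  proof (induction i)
    case (Suc i)
    show ?case
      using measurable_comp[OF Suc measurable_odometer[OF assms]] by (simp add: comp_def)
  qed simp
  then have "(\<lambda>x. phi p ((odometer p ^^ i) x)) \<in> haar p \<rightarrow>\<^sub>M count_space UNIV" for i
    by (rule measurable_compose) simp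
  then show ?thesis
    unfolding phi_sum_def by measurable
qed

lemma phi_le: "x \<in> padic p \<Longrightarrow> phi p x \<le> p - 1"
proof -
  assume "x \<in> padic p"
  then have "phi p x < p"
    by (simp add: phi_def padic_def)
  then show ?thesis
    by linarith
qed

lemma phi_sum_le:
  assumes "p \<ge> 1" "x \<in> padic p"
  shows "phi_sum p m x \<le> m * (p - 1)"
proof -
  have "phi_sum p m x \<le> (\<Sum>i<m. p - 1)"
    unfolding phi_sum_def by (intro sum_mono phi_le odometer_pow_in_padic assms)
  then show ?thesis by simp
qed

lemma poly_P_poly:
  assumes "p \<ge> 1"
  shows "poly (P_poly p m) t = (\<integral>x. t ^ phi_sum p m x \<partial>haar p)"
proof -
  interpret prob_space "haar p" by (rule prob_space_haar[OF assms])
  let ?A = "\<lambda>j. {x \<in> padic p. phi_sum p m x = j}"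
  have A: "?A j \<in> sets (haar p)" for j
    using measurable_sets[OF measurable_phi_sum[OF assms, of m], of "{j}"]
    by (simp add: space_haar vimage_def Int_def conj_commute)
  have "(\<integral>x. t ^ phi_sum p m x \<partial>haar p)
      = (\<integral>x. (\<Sum>j\<le>m * (p - 1). t ^ j * indicator (?A j) x) \<partial>haar p)"
  proof (rule Bochner_Integration.integral_cong)
    fix x assume "x \<in> space (haar p)"
    then have x: "x \<in> padic p" by (simp add: space_haar)
    have "(\<Sum>j\<le>m * (p - 1). t ^ j * indicator (?A j) x)
        = (\<Sum>j\<le>m * (p - 1). if j = phi_sum p m x then t ^ j else 0)"
      by (rule sum.cong) (auto simp: x indicator_def)
    then show "t ^ phi_sum p m x = (\<Sum>j\<le>m * (p - 1). t ^ j * indicator (?A j) x)"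
      using phi_sum_le[OF assms x, of m] by (simp add: sum.delta)
  qed simp
  also have "\<dots> = (\<Sum>j\<le>m * (p - 1). t ^ j * measure (haar p) (?A j))"
    using A sets.sets_into_space[OF A]
    by (subst Bochner_Integration.integral_sum)
       (auto simp: emeasure_eq_measure Int_absorb2 intro!: integrable_mult_right integrable_real_indicator)
  finally show ?thesis
    by (simp add: P_poly_def poly_sum poly_monom mult.commute)
qed

lemma length_subst_word: "q < p - 1 \<Longrightarrow> length (subst_word p q) = p"
proof -
  assume q: "q < p - 1"
  have "length (concat (map (\<lambda>i. if i = q then [i, i] else [i]) xs)) = (\<Sum>i\<leftarrow>xs. if i = q then 2 else 1)"
    for xs by (induction xs) auto
  then have "length (subst_word p q) = (\<Sum>i\<leftarrow>rev [0..<p - 1]. if i = q then 2 else 1)"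
    by (simp add: subst_word_def)
  also have "\<dots> = (\<Sum>i<p - 1. 1 + (if i = q then 1 else 0))"
    by (subst sum_list_distinct_conv_sum_set) (auto intro!: sum.cong simp: atLeast0LessThan)
  also have "\<dots> = p"
    using q by (subst sum.distrib) (simp add: sum.delta)
  finally show ?thesis .
qed

lemma set_subst_word: "set (subst_word p q) \<subseteq> {..<p - 1}"
  by (auto simp: subst_word_def split: if_splits)

lemma set_S_hat_word: "p \<ge> 2 \<Longrightarrow> set (S_hat_word p l) \<subseteq> {..<p - 1}"
  using set_subst_word by (cases l) fastforce+

lemma length_S_hat_word:
  assumes "p \<ge> 2" shows "length (S_hat_word p l) = p ^ (l + 1)"
proof (induction l)
  case (Suc l)
  have "map (length \<circ> subst_word p) (S_hat_word p l) = map (\<lambda>_. p) (S_hat_word p l)"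
    using set_S_hat_word[OF assms, of l] by (auto intro!: length_subst_word)
  then show ?case
    using Suc by (simp add: length_concat sum_list_triv del: map_eq_conv)
qed (use assms in auto)

lemma prefix_S_hat_word_Suc:
  assumes "p \<ge> 2" shows "prefix (S_hat_word p l) (S_hat_word p (Suc l))"
proof (induction l)
  case 0
  obtain n where n: "p = Suc (Suc n)"
    using assms by (metis add_2_eq_Suc le_Suc_ex)
  have "map (\<lambda>i. if i = n then [i, i] else [i]) (rev [0..<n]) = map (\<lambda>i. [i]) (rev [0..<n])"
    by auto
  moreover have "concat (map (\<lambda>i. [i]) (rev [0..<n])) = rev [0..<n]"
    by (simp add: concat_map_singleton[where f = "\<lambda>i. i"])
  ultimately have "concat (map (\<lambda>i. if i = n then [i, i] else [i]) (rev [0..<n])) = rev [0..<n]"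
    by metis
  then have "subst_word p n = S_hat_word p 0"
    by (simp add: subst_word_def n)
  then show ?case
    by (simp add: n)
next
  case (Suc l)
  then show ?case
    by (auto simp: prefix_def)
qed

lemma prefix_S_hat_word:
  assumes "p \<ge> 2" "l \<le> l'" shows "prefix (S_hat_word p l) (S_hat_word p l')"
  using assms(2)
proof (induction l' rule: dec_induct)
  case (step k)
  show ?case
    using prefix_order.trans[OF step.IH prefix_S_hat_word_Suc[OF assms(1)]] .
qed simp

lemma S_hat_prefix:
  assumes "p \<ge> 2"
  shows "map (S_hat p) [0..<p ^ (l + 1)] = S_hat_word p l"
proof (rule nth_equalityI)
  fix j assume "j < length (map (S_hat p) [0..<p ^ (l + 1)])"
  then have j: "j < p ^ (l + 1)" by simp
  have "j < 2 ^ (j + 1)" using less_exp[of "Suc j"] by simp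
  also have "\<dots> \<le> p ^ (j + 1)" using assms by (rule power_mono) simp
  finally have j': "j < p ^ (j + 1)" .
  have "S_hat_word p j ! j = S_hat_word p l ! j"
    using prefix_S_hat_word[OF assms, of j l] prefix_S_hat_word[OF assms, of l j]
      length_S_hat_word[OF assms, of j] length_S_hat_word[OF assms, of l] j j'
    by (metis nat_le_linear nth_append prefix_def)
  then show "map (S_hat p) [0..<p ^ (l + 1)] ! j = S_hat_word p l ! j"
    using j by (simp add: S_hat_def del: upt_Suc)
qed (simp add: length_S_hat_word[OF assms])

end

theory Submission
  imports Defs
begin

text \<open>
  Call \<open>x\<close> generic if infinitely many of its digits differ from \<open>p - 1\<close>. Generic points have full
  measure, and \<open>phi_sum p m\<close> is locally constant at them, so \<open>P_deg p m\<close> is the maximum of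
  \<open>phi_sum p m\<close> over generic points. Along the orbit of a point with first digit \<open>a\<close> and tail \<open>y\<close>,
  \<open>phi\<close> runs through \<open>0, \<dots>, p - 2\<close> cyclically starting at \<open>a\<close>, and after each \<open>p - 2\<close> inserts the next
  value of \<open>phi\<close> along the orbit of \<open>y\<close>. Since \<open>a\<close> and \<open>y\<close> can be chosen independently, maximising
  over \<open>a\<close> expresses the maximum \<open>D\<close> at \<open>m = n * p + r\<close> by \<open>D n\<close> and \<open>D (n + 1)\<close>: the best window of
  length \<open>m\<close> either starts at \<open>a = p - 1 - r\<close> and meets \<open>n\<close> inserted values, or starts at \<open>a = p - r\<close>
  and meets \<open>n + 1\<close> of them. The partial sums of the substitution sequence satisfy the same
  recursion. At \<open>m = 1\<close> the recursion is self-referential, and \<open>D 1 = p - 2\<close> is read off directly.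
\<close>

section \<open>Generic points and the odometer on a first digit and a tail\<close>

text \<open>Having one digit other than \<open>p - 1\<close> is not preserved: the odometer sends
  \<open>p - 2\<close> followed by all \<open>p - 1\<close> to the constant sequence. Having
  infinitely many is unaffected by changing, adding or removing finitely many digits.\<close>

definition padic_generic :: "nat \<Rightarrow> (nat \<Rightarrow> nat) set" where
  "padic_generic p = {x \<in> padic p. \<exists>\<^sub>\<infinity>k. x k \<noteq> p - 1}"

lemma odometer_nth:
  assumes "x \<in> padic p" "p \<ge> 2"
  shows "odometer p x k = (if \<forall>i<k. x i = p - 1 then (x k + 1) mod p else x k)"
proof -
  have lt: "x i < p" for i
    using assms(1) by (auto simp: padic_def)
  \<comment> \<open>The added unit acts as the carry into position 0, where \<open>carry\<close>
    itself is 0; hence the closed form starts at index 1.\<close>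
  have carry: "carry p x padic_one (Suc k) = (if \<forall>i<Suc k. x i = p - 1 then 1 else 0)" for k
  proof (induction k)
    case 0
    show ?case
      using lt[of 0] assms(2) by (cases "x 0 = p - 1") (auto simp: padic_one_def)
  next
    case (Suc k)
    have "carry p x padic_one (Suc (Suc k)) = (x (Suc k) + carry p x padic_one (Suc k)) div p"
      by (simp add: padic_one_def)
    also have "\<dots> = (if \<forall>i<Suc (Suc k). x i = p - 1 then 1 else 0)"
      unfolding Suc All_less_Suc[of "Suc k"]
      using lt[of "Suc k"] assms(2) by (cases "x (Suc k) = p - 1") auto
    finally show ?case .
  qed
  show ?thesis
  proof (cases k)
    case 0
    then show ?thesis
      by (simp add: odometer_def add_carry_def padic_one_def)
  next
    case (Suc n)
    have "odometer p x k = (x k + carry p x padic_one (Suc n)) mod p"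
      by (simp add: odometer_def add_carry_def padic_one_def Suc del: carry.simps)
    then show ?thesis
      unfolding carry using lt[of k] by (auto simp: Suc)
  qed
qed

lemma odometer_case_nat:
  assumes "y \<in> padic p" "a < p" "p \<ge> 2"
  shows "odometer p (case_nat a y) =
    (if a = p - 1 then case_nat 0 (odometer p y) else case_nat (Suc a) y)"
proof
  fix k
  have "case_nat a y \<in> padic p"
    using assms by (auto simp: padic_def split: nat.split)
  then show "odometer p (case_nat a y) k =
    (if a = p - 1 then case_nat 0 (odometer p y) else case_nat (Suc a) y) k"
    using assms by (cases k) (auto simp: odometer_nth All_less_Suc2)
qed

text \<open>The first digit counts modulo \<open>p\<close>, and each wrap-around moves the tail
  \<open>y\<close> one step along its own orbit.\<close>

lemma odometer_pow_case_nat: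
  assumes "y \<in> padic p" "a < p" "p \<ge> 2"
  shows "(odometer p ^^ i) (case_nat a y) =
    case_nat ((a + i) mod p) ((odometer p ^^ ((a + i) div p)) y)"
proof (induction i)
  case 0
  have "(a + 0) mod p = a" "(a + 0) div p = 0"
    using assms by simp_all
  then show ?case
    by (simp only: funpow_0)
next
  case (Suc i)
  let ?n = "(a + i) div p" and ?b = "(a + i) mod p"
  have "(odometer p ^^ ?n) y \<in> padic p"
    using assms odometer_pow_in_padic by simp
  then have "(odometer p ^^ Suc i) (case_nat a y) = (if ?b = p - 1
    then case_nat 0 ((odometer p ^^ Suc ?n) y) else case_nat (Suc ?b) ((odometer p ^^ ?n) y))"
    using assms by (simp add: Suc odometer_case_nat)
  moreover have "(a + Suc i) mod p = (if ?b = p - 1 then 0 else Suc ?b)"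
    "(a + Suc i) div p = (if ?b = p - 1 then Suc ?n else ?n)"
    using assms by (auto simp: mod_Suc div_Suc)
  ultimately show ?case
    by presburger
qed

lemma padic_genericD:
  assumes "x \<in> padic_generic p"
  shows "x \<in> padic p" "\<exists>k. x k \<noteq> p - 1"
  using assms frequently_ex by (auto simp: padic_generic_def)

text \<open>Digits beyond one that differs from \<open>p - 1\<close> receive no carry and stay
  unchanged.\<close>

lemma odometer_in_padic_generic:
  assumes "x \<in> padic_generic p" "p \<ge> 2"
  shows "odometer p x \<in> padic_generic p"
proof -
  obtain n where n: "x n \<noteq> p - 1"
    using padic_genericD(2)[OF assms(1)] by blast
  have "odometer p x k = x k" if "k > n" for k
    using odometer_nth[OF padic_genericD(1)[OF assms(1)] assms(2), of k] n that by auto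
  then have *: "\<forall>\<^sub>\<infinity>k. odometer p x k = x k"
    using MOST_nat by blast
  have "\<exists>\<^sub>\<infinity>k. x k \<noteq> p - 1"
    using assms(1) by (simp add: padic_generic_def)
  from INFM_conjI[OF this *] have "\<exists>\<^sub>\<infinity>k. odometer p x k \<noteq> p - 1"
    by (rule INFM_mono) auto
  then show ?thesis
    using odometer_in_padic[of p x] assms(2) by (simp add: padic_generic_def)
qed

lemma odometer_pow_in_padic_generic:
  "x \<in> padic_generic p \<Longrightarrow> p \<ge> 2 \<Longrightarrow> (odometer p ^^ i) x \<in> padic_generic p"
  by (induction i) (auto simp: odometer_in_padic_generic)

lemma case_nat_in_padic_generic_iff:
  "case_nat a y \<in> padic_generic p \<longleftrightarrow> a < p \<and> y \<in> padic_generic p"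
proof -
  have "(\<exists>\<^sub>\<infinity>k. case_nat a y k \<noteq> p - 1) \<longleftrightarrow> (\<exists>\<^sub>\<infinity>k. y k \<noteq> p - 1)"
    using MOST_Suc_iff[of "\<lambda>k. case_nat a y k = p - 1"]
    unfolding frequently_def not_not nat.case by blast
  moreover have "case_nat a y \<in> padic p \<longleftrightarrow> a < p \<and> y \<in> padic p"
  proof
    assume "case_nat a y \<in> padic p"
    then have "case_nat a y k < p" for k
      by (simp add: padic_def)
    from this[of 0] this[of "Suc k" for k] show "a < p \<and> y \<in> padic p"
      by (simp add: padic_def)
  next
    assume "a < p \<and> y \<in> padic p"
    then show "case_nat a y \<in> padic p"
      by (auto simp: padic_def split: nat.split)
  qed
  ultimately show ?thesis
    by (simp add: padic_generic_def)
qed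

lemma phi_case_nat:
  assumes "y \<in> padic_generic p"
  shows "phi p (case_nat a y) = (if a = p - 1 then phi p y else a)"
proof (cases "a = p - 1")
  case True
  obtain k where "y k \<noteq> p - 1"
    using padic_genericD(2)[OF assms] by blast
  then have "(LEAST k. case_nat a y k \<noteq> p - 1) = Suc (LEAST k. y k \<noteq> p - 1)"
    using Least_Suc[of "\<lambda>k. case_nat a y k \<noteq> p - 1" "Suc k"] True by simp
  then show ?thesis
    unfolding phi_def True by simp
next
  case False
  then have "(LEAST k. case_nat a y k \<noteq> p - 1) = 0"
    by (intro Least_eq_0) simp
  then show ?thesis
    using False by (simp add: phi_def)
qed

section \<open>Sums of \<open>phi\<close> along an orbit\<close>

text \<open>\<open>tri (p - 1)\<close> is what a full cycle of first digits contributes besides the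
  value inserted from the tail.\<close>

definition tri :: "nat \<Rightarrow> nat" where
  "tri k = \<Sum>{..<k}"

lemma tri_Suc [simp]: "tri 0 = 0" "tri (Suc k) = tri k + k"
  by (simp_all add: tri_def)

lemma two_tri: "2 * int (tri k) = int k * int k - int k"
  by (induction k) (auto simp: algebra_simps)

text \<open>Adding \<open>tri a\<close> moves the start back to first digit 0, so that
  \<open>a + m\<close> steps split into full cycles, each with one inserted value of the tail, and
  an incomplete one.\<close>

lemma phi_sum_case_nat:
  assumes "y \<in> padic_generic p" "a < p" "p \<ge> 2"
  shows "phi_sum p m (case_nat a y) + tri a =
    tri (p - 1) * ((a + m) div p) + tri ((a + m) mod p) + phi_sum p ((a + m) div p) y"
proof (induction m)
  case 0
  show ?case
    using assms by (simp add: phi_sum_def)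
next
  case (Suc m)
  have step: "phi_sum p (Suc n) z = phi_sum p n z + phi p ((odometer p ^^ n) z)" for n z
    by (simp add: phi_sum_def)
  have "phi p ((odometer p ^^ m) (case_nat a y)) =
    (if (a + m) mod p = p - 1 then phi p ((odometer p ^^ ((a + m) div p)) y) else (a + m) mod p)"
    unfolding odometer_pow_case_nat[OF padic_genericD(1)[OF assms(1)] assms(2,3)]
    by (rule phi_case_nat) (intro odometer_pow_in_padic_generic assms)
  moreover have "(a + Suc m) mod p = (if (a + m) mod p = p - 1 then 0 else Suc ((a + m) mod p))"
    "(a + Suc m) div p = (if (a + m) mod p = p - 1 then Suc ((a + m) div p) else (a + m) div p)"
    using assms by (auto simp: mod_Suc div_Suc)
  ultimately show ?case
    using Suc by (cases "(a + m) mod p = p - 1") (simp_all add: step)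
qed

section \<open>The substitution sequence and its partial sums\<close>

text \<open>Doubling \<open>q\<close> amounts to cutting the decreasing list at \<open>q\<close> and
  keeping \<open>q\<close> in both pieces.\<close>

lemma subst_word_eq:
  assumes "q < p - 1"
  shows "subst_word p q = rev [q..<p - 1] @ rev [0..<Suc q]"
proof -
  let ?f = "\<lambda>i. if i = q then [i, i] else [i]"
  have sing: "concat (map ?f xs) = xs" if "q \<notin> set xs" for xs
    using that by (induction xs) auto
  have "[0..<p - 1] = [0..<q] @ q # [Suc q..<p - 1]"
    using assms upt_add_eq_append[of 0 q "p - 1 - q"] by (simp add: upt_conv_Cons)
  then have "subst_word p q = rev [Suc q..<p - 1] @ [q, q] @ rev [0..<q]"
    by (simp add: subst_word_def sing)
  then show ?thesis
    using assms by (simp add: upt_conv_Cons)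
qed

lemma subst_word_nth:
  assumes "q < p - 1" "r < p"
  shows "subst_word p q ! r = (if r + q < p - 1 then p - 2 - r else p - 1 - r)"
  using assms by (auto simp: subst_word_eq nth_append rev_nth simp del: upt_Suc)

lemma concat_nth_uniform:
  assumes "\<forall>xs \<in> set xss. length xs = p" "n < length xss" "r < p"
  shows "concat xss ! (n * p + r) = xss ! n ! r"
  using assms
proof (induction xss arbitrary: n)
  case (Cons xs xss)
  then show ?case
    by (cases n) (auto simp: nth_append)
qed simp

lemma S_hat_eq_nth:
  assumes "p \<ge> 2" "j < p ^ (l + 1)"
  shows "S_hat p j = S_hat_word p l ! j"
  using S_hat_prefix[OF assms(1), of l] assms(2)
  by (metis add_0 diff_zero length_upt nth_map nth_upt)

lemma less_power_Suc: "p \<ge> 2 \<Longrightarrow> j < p ^ (j + 1)" for j p :: nat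
  by (rule order_less_le_trans[OF _ power_mono[of 2 p "j + 1"]]) (use less_exp[of "Suc j"] in simp_all)

lemma S_hat_less:
  assumes "p \<ge> 2"
  shows "S_hat p j < p - 1"
proof -
  have "S_hat_word p j ! j \<in> set (S_hat_word p j)"
    by (rule nth_mem) (unfold length_S_hat_word[OF assms], rule less_power_Suc[OF assms])
  then show ?thesis
    using set_S_hat_word[OF assms, of j] unfolding S_hat_def by blast
qed

text \<open>The sequence is fixed by the substitution: its block \<open>n\<close> of length
  \<open>p\<close> is the image of its letter \<open>n\<close>.\<close>

lemma S_hat_rec:
  assumes "p \<ge> 2" "r < p"
  shows "S_hat p (n * p + r) =
    (if r + S_hat p n < p - 1 then p - 2 - r else p - 1 - r)"
proof -
  \<comment> \<open>Letter \<open>n\<close> already occurs in word \<open>n\<close>, so its image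
    lies in word \<open>Suc n\<close>.\<close>
  note n = less_power_Suc[OF assms(1), of n]
  have "n * p + r < Suc n * p"
    using assms(2) by simp
  also have "\<dots> \<le> p ^ (n + 1) * p"
    using n by (intro mult_le_mono1) simp
  finally have "n * p + r < p ^ (Suc n + 1)"
    by (simp add: mult.commute)
  from S_hat_eq_nth[OF assms(1) this]
  have "S_hat p (n * p + r) = concat (map (subst_word p) (S_hat_word p n)) ! (n * p + r)"
    by simp
  also have "\<dots> = map (subst_word p) (S_hat_word p n) ! n ! r"
    using set_S_hat_word[OF assms(1), of n] length_subst_word[of _ p] assms(2) n
    by (intro concat_nth_uniform) (auto simp: length_S_hat_word[OF assms(1)])
  also have "\<dots> = subst_word p (S_hat p n) ! r"
    using n S_hat_eq_nth[OF assms(1) n] by (simp add: length_S_hat_word[OF assms(1)])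
  finally show ?thesis
    using subst_word_nth[OF S_hat_less[OF assms(1)] assms(2)] by simp
qed

lemma S_hat_0: "p \<ge> 2 \<Longrightarrow> S_hat p 0 = p - 2"
  by (simp add: S_hat_def)

definition S_hat_sum :: "nat \<Rightarrow> nat \<Rightarrow> nat" where
  "S_hat_sum p m = sum (S_hat p) {..<m}"

lemma S_hat_sum_simps [simp]:
  "S_hat_sum p 0 = 0" "S_hat_sum p (Suc m) = S_hat_sum p m + S_hat p m"
  by (simp_all add: S_hat_sum_def)

text \<open>
  The letter \<open>S_hat p n\<close> is the one repeated in block \<open>n\<close>; from the repetition on, the block is the
  decreasing word shifted up by one, which gives the last summand.
\<close>

lemma S_hat_sum_within_block:
  assumes "p \<ge> 2" "r \<le> p"
  shows "int (S_hat_sum p (n * p + r)) = int (S_hat_sum p (n * p)) + int r * (int p - 2) - int (tri r)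
    + max 0 (int r + int (S_hat p n) - (int p - 1))"
  using assms(2)
proof (induction r)
  case 0
  then show ?case
    using S_hat_less[OF assms(1), of n] assms by simp
next
  case (Suc r)
  have "int (S_hat p (n * p + r)) =
    (if int r + int (S_hat p n) < int p - 1 then int p - 2 - int r else int p - 1 - int r)"
    using S_hat_rec[OF assms(1), of r n] S_hat_less[OF assms(1), of n] Suc.prems by auto
  then show ?case
    using Suc by (auto simp: algebra_simps max_def)
qed

text \<open>A complete block \<open>k\<close> lists every letter once, for
  \<open>tri (p - 1)\<close>, and \<open>S_hat p k\<close> once more.\<close>

lemma S_hat_sum_mult:
  assumes "p \<ge> 2"
  shows "S_hat_sum p (n * p) = n * tri (p - 1) + S_hat_sum p n"
proof (induction n)
  case (Suc n)
  have "2 * int (tri (p - 1)) = (int p - 1) * (int p - 2)"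
    using two_tri[of "p - 1"] assms by (simp add: of_nat_diff algebra_simps)
  then have "int (S_hat_sum p (n * p + p)) = int (Suc n * tri (p - 1) + S_hat_sum p (Suc n))"
    using S_hat_sum_within_block[OF assms order_refl, of n] two_tri[of p] Suc
    by (simp add: algebra_simps)
  then have "S_hat_sum p (n * p + p) = Suc n * tri (p - 1) + S_hat_sum p (Suc n)"
    by (simp only: of_nat_eq_iff)
  then show ?case
    by (simp add: add.commute)
qed simp

text \<open>Doubling clears the denominators of the triangular numbers; the comparison with
  \<open>phi_sum_case_nat_int\<close> is then integer polynomial arithmetic.\<close>

lemma S_hat_sum_rec:
  assumes "p \<ge> 2" "r \<le> p"
  shows "2 * int (S_hat_sum p (n * p + r)) =
    int n * ((int p - 1) * (int p - 2)) + 2 * int (S_hat_sum p n) + 2 * int r * (int p - 2)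
    - int r * int r + int r + 2 * max 0 (int r + int (S_hat p n) - (int p - 1))"
proof -
  have "2 * int (tri (p - 1)) = (int p - 1) * (int p - 2)"
    using two_tri[of "p - 1"] assms by (simp add: of_nat_diff algebra_simps)
  then have "2 * int (n * tri (p - 1)) = int n * ((int p - 1) * (int p - 2))"
    by simp
  then show ?thesis
    unfolding S_hat_sum_within_block[OF assms] S_hat_sum_mult[OF assms(1)]
    using two_tri[of r] by (simp add: algebra_simps)
qed

section \<open>The maximum of \<open>phi_sum\<close> over generic points\<close>

lemma phi_le_generic:
  assumes "x \<in> padic_generic p" "p \<ge> 2"
  shows "phi p x \<le> p - 2"
proof -
  have "x (LEAST k. x k \<noteq> p - 1) \<noteq> p - 1"
    using padic_genericD(2)[OF assms(1)] by (rule LeastI_ex)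
  moreover have "phi p x \<le> p - 1"
    by (rule phi_le[OF padic_genericD(1)[OF assms(1)]])
  ultimately show ?thesis
    by (simp add: phi_def)
qed

text \<open>Since \<open>a + r < 2 * p\<close>, the first digit wraps around either \<open>n\<close>
  or \<open>n + 1\<close> times.\<close>

lemma phi_sum_case_nat_int:
  assumes "y \<in> padic_generic p" "a < p" "p \<ge> 2" "r < p"
  shows "2 * int (phi_sum p (n * p + r) (case_nat a y)) =
    (if a + r < p then int n * ((int p - 1) * (int p - 2)) + 2 * int a * int r + int r * int r - int r
       + 2 * int (phi_sum p n y)
     else (int n + 1) * ((int p - 1) * (int p - 2))
       + (int a + int r - int p) * (int a + int r - int p - 1) - int a * (int a - 1)
       + 2 * int (phi_sum p (Suc n) y))"
proof -
  have T: "2 * int (tri (p - 1)) = (int p - 1) * (int p - 2)"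
    using two_tri[of "p - 1"] assms by (simp add: of_nat_diff algebra_simps)
  let ?L = "(a + (n * p + r)) div p" and ?R = "(a + (n * p + r)) mod p"
  have *: "2 * int (phi_sum p (n * p + r) (case_nat a y)) =
     int ?L * (2 * int (tri (p - 1))) + 2 * int (tri ?R) - 2 * int (tri a) + 2 * int (phi_sum p ?L y)"
    using arg_cong[OF phi_sum_case_nat[OF assms(1-3), of "n * p + r"], of int]
    by (simp only: of_nat_add of_nat_mult) (simp only: algebra_simps)
  have eq: "a + (n * p + r) = (a + r) + n * p"
    by simp
  show ?thesis
  proof (cases "a + r < p")
    case True
    then have "?L = n" "?R = a + r"
      by (simp_all only: eq div_mult_self1 mod_mult_self1, simp_all)
    then show ?thesis
      using True unfolding * T unfolding two_tri by (simp add: algebra_simps)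
  next
    case False
    have "a + (n * p + r) = (a + r - p) + Suc n * p"
      using False by simp
    moreover have "a + r - p < p"
      using assms by simp
    ultimately have "?L = Suc n" "?R = a + r - p"
      by (metis div_mult_self1 div_less add_0_right add.commute gr_implies_not0)
         (metis \<open>a + (n * p + r) = (a + r - p) + Suc n * p\<close> \<open>a + r - p < p\<close> mod_mult_self1 mod_less)
    then show ?thesis
      using False unfolding * T unfolding two_tri by (simp add: algebra_simps of_nat_diff)
  qed
qed

text \<open>Descent for the inductions on \<open>m\<close>. At \<open>m = 1\<close> one has
  \<open>n = 0\<close> and \<open>r = 1\<close>, so \<open>Suc n = m\<close> and the second bound
  fails.\<close>

lemma quotient_less:
  assumes "p \<ge> 2" "m \<ge> 2" "m = n * p + r" "r < p"
  shows "n < m" "r > 0 \<Longrightarrow> Suc n < m"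
proof -
  have "2 * n \<le> n * p"
    using assms(1) by simp
  then show "n < m" "r > 0 \<Longrightarrow> Suc n < m"
    using assms by (cases n; auto)+
qed

lemma phi_sum_le_S_hat_sum:
  assumes "p \<ge> 2" "x \<in> padic_generic p"
  shows "phi_sum p m x \<le> S_hat_sum p m"
  using assms(2)
proof (induction m arbitrary: x rule: less_induct)
  case (less m)
  consider "m = 0" | "m = 1" | "m \<ge> 2"
    by linarith
  then show ?case
  proof cases
    case 1
    then show ?thesis by (simp add: phi_sum_def)
  next
    case 2
    then show ?thesis
      using phi_le_generic[OF less.prems assms(1)] by (simp add: phi_sum_def S_hat_0 assms)
  next
    case 3
    define n r where "n = m div p" and "r = m mod p"
    have m: "m = n * p + r" and r: "r < p"
      using assms by (simp_all add: n_def r_def)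
    define a y where "a = x 0" and "y = (\<lambda>k. x (Suc k))"
    have x: "x = case_nat a y"
      by (auto simp: a_def y_def split: nat.split)
    with less.prems have y: "y \<in> padic_generic p" and a: "a < p"
      by (auto simp: case_nat_in_padic_generic_iff)
    let ?q = "S_hat p n"
    show ?thesis
    proof (cases "a + r < p")
      case True
      have "phi_sum p n y \<le> S_hat_sum p n"
        using less.IH[OF quotient_less(1)[OF assms(1) 3 m r] y] .
      \<comment> \<open>With \<open>n\<close> wrap-arounds the sum grows with \<open>a\<close>, so
        the extreme start is \<open>a = p - 1 - r\<close>; it matches the recursion with 0 for the
        maximum.\<close>
      moreover have "int a * int r \<le> (int p - 1 - int r) * int r"
        using True by (intro mult_right_mono) auto
      ultimately have "2 * int (phi_sum p m x) \<le> 2 * int (S_hat_sum p m)"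
        using True r unfolding x m phi_sum_case_nat_int[OF y a assms(1) r]
          S_hat_sum_rec[OF assms(1) less_imp_le[OF r]]
        by (simp add: algebra_simps max_def)
      then show ?thesis by simp
    next
      case False
      have "r > 0"
        using False a by (cases r) auto
      then have "phi_sum p (Suc n) y \<le> S_hat_sum p (Suc n)"
        using less.IH[OF quotient_less(2)[OF assms(1) 3 m r] y] by simp
      \<comment> \<open>With \<open>n + 1\<close> wrap-arounds the sum decreases in
        \<open>a\<close>, and this product is the loss against the extreme start
        \<open>a = p - r\<close>, which matches the other argument of the maximum.\<close>
      moreover have "0 \<le> (int a + int r - int p) * (int p - int r)"
        using False r by (intro mult_nonneg_nonneg) auto
      ultimately have "2 * int (phi_sum p m x) \<le> 2 * int (S_hat_sum p m)"
        using False r unfolding x m phi_sum_case_nat_int[OF y a assms(1) r]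
          S_hat_sum_rec[OF assms(1) less_imp_le[OF r]]
        by (simp add: algebra_simps max_def)
      then show ?thesis by simp
    qed
  qed
qed

lemma phi_sum_attains_S_hat_sum:
  assumes "p \<ge> 2"
  shows "\<exists>x \<in> padic_generic p. phi_sum p m x = S_hat_sum p m"
proof (induction m rule: less_induct)
  case (less m)
  have zero: "(\<lambda>_. 0) \<in> padic_generic p"
    using assms by (auto simp: padic_generic_def padic_def)
  consider "m = 0" | "m = 1" | "m \<ge> 2"
    by linarith
  then show ?case
  proof cases
    case 1
    then show ?thesis
      using zero by (auto simp: phi_sum_def)
  next
    case 2
    have "case_nat (p - 2) (\<lambda>_. 0) \<in> padic_generic p"
      using zero assms by (simp add: case_nat_in_padic_generic_iff)
    moreover have "phi_sum p m (case_nat (p - 2) (\<lambda>_. 0)) = S_hat_sum p m"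
      using 2 assms by (simp add: phi_sum_def phi_case_nat[OF zero] S_hat_0)
    ultimately show ?thesis by blast
  next
    case 3
    define n r where "n = m div p" and "r = m mod p"
    have m: "m = n * p + r" and r: "r < p"
      using assms by (simp_all add: n_def r_def)
    let ?q = "S_hat p n"
    show ?thesis
    \<comment> \<open>This decides which argument of the maximum in \<open>S_hat_sum_rec\<close>
      counts; at \<open>r + ?q = p - 1\<close> both are 0.\<close>
    proof (cases "r + ?q < p")
      case True
      obtain y where y: "y \<in> padic_generic p" "phi_sum p n y = S_hat_sum p n"
        using less.IH[OF quotient_less(1)[OF assms(1) 3 m r]] by blast
      \<comment> \<open>The largest first digit with only \<open>n\<close> wrap-arounds.\<close>
      define a where "a = p - 1 - r"
      have a: "a < p" "a + r < p" "int a = int p - 1 - int r"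
        using r by (auto simp: a_def)
      have "2 * int (phi_sum p m (case_nat a y)) = 2 * int (S_hat_sum p m)"
        using True r a(2) unfolding m phi_sum_case_nat_int[OF y(1) a(1) assms(1) r]
          S_hat_sum_rec[OF assms(1) less_imp_le[OF r]] a(3) y(2)
        by (simp add: algebra_simps)
      then show ?thesis
        using y(1) a(1) by (intro bexI[of _ "case_nat a y"]) (auto simp: case_nat_in_padic_generic_iff)
    next
      case False
      have r0: "r > 0"
        using False S_hat_less[OF assms, of n] by (cases r) auto
      obtain y where y: "y \<in> padic_generic p" "phi_sum p (Suc n) y = S_hat_sum p (Suc n)"
        using less.IH[OF quotient_less(2)[OF assms(1) 3 m r r0]] by blast
      \<comment> \<open>The smallest first digit with \<open>n + 1\<close> wrap-arounds.\<close>
      define a where "a = p - r"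
      have a: "a < p" "\<not> a + r < p" "int a = int p - int r"
        using r r0 by (auto simp: a_def)
      have "2 * int (phi_sum p m (case_nat a y)) = 2 * int (S_hat_sum p m)"
        using False r a(2) unfolding m phi_sum_case_nat_int[OF y(1) a(1) assms(1) r]
          S_hat_sum_rec[OF assms(1) less_imp_le[OF r]] a(3) y(2)
        by (simp add: algebra_simps)
      then show ?thesis
        using y(1) a(1) by (intro bexI[of _ "case_nat a y"]) (auto simp: case_nat_in_padic_generic_iff)
    qed
  qed
qed

section \<open>Local constancy of \<open>phi_sum\<close>\<close>

text \<open>Carries move only to the right, so a digit of the image depends on no later
  digit.\<close>

lemma odometer_pow_cong_prefix:
  assumes "x \<in> padic p" "y \<in> padic p" "p \<ge> 2" "\<forall>k<N. y k = x k" "k < N"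
  shows "(odometer p ^^ i) y k = (odometer p ^^ i) x k"
  using assms(5)
proof (induction i arbitrary: k)
  case (Suc i)
  have "(odometer p ^^ i) x \<in> padic p" "(odometer p ^^ i) y \<in> padic p"
    using assms odometer_pow_in_padic by simp_all
  then show ?case
    using Suc assms(3) by (auto simp: odometer_nth)
qed (use assms in simp)

lemma phi_cong_prefix:
  assumes "x n \<noteq> p - 1" "\<forall>k\<le>n. y k = x k"
  shows "phi p y = phi p x"
proof -
  let ?l = "LEAST k. x k \<noteq> p - 1"
  have l: "?l \<le> n" "x ?l \<noteq> p - 1"
    using Least_le[of "\<lambda>k. x k \<noteq> p - 1" n] LeastI[of "\<lambda>k. x k \<noteq> p - 1" n] assms(1) by blast+
  have "(LEAST k. y k \<noteq> p - 1) = ?l"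
  proof (rule Least_equality)
    show "y ?l \<noteq> p - 1"
      using l assms(2) by simp
    show "?l \<le> k" if "y k \<noteq> p - 1" for k
    proof (cases "k \<le> n")
      case True
      then show ?thesis
        using that assms(2) by (intro Least_le) auto
    qed (use l in simp)
  qed
  then show ?thesis
    using l assms(2) by (simp add: phi_def)
qed

lemma phi_sum_locally_constant:
  assumes "x \<in> padic_generic p" "p \<ge> 2"
  shows "\<exists>N. \<forall>y \<in> padic p. (\<forall>k<N. y k = x k) \<longrightarrow> phi_sum p m y = phi_sum p m x"
proof -
  have "\<forall>i. \<exists>k. (odometer p ^^ i) x k \<noteq> p - 1"
    using padic_genericD(2)[OF odometer_pow_in_padic_generic[OF assms]] by blast
  then obtain f where f: "(odometer p ^^ i) x (f i) \<noteq> p - 1" for i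
    by metis
  \<comment> \<open>\<open>Suc\<close> of the sum exceeds every \<open>f i\<close> with
    \<open>i < m\<close>, so one prefix length serves all \<open>m\<close> orbit points.\<close>
  have "phi_sum p m y = phi_sum p m x"
    if y: "y \<in> padic p" "\<forall>k<Suc (\<Sum>i<m. f i). y k = x k" for y
    unfolding phi_sum_def
  proof (rule sum.cong[OF refl])
    fix i
    assume "i \<in> {..<m}"
    then have "f i < Suc (\<Sum>i<m. f i)"
      using member_le_sum[of i "{..<m}" f] by simp
    then have "\<forall>k\<le>f i. (odometer p ^^ i) y k = (odometer p ^^ i) x k"
      using odometer_pow_cong_prefix[OF padic_genericD(1)[OF assms(1)] y(1) assms(2) y(2)] by simp
    then show "phi p ((odometer p ^^ i) y) = phi p ((odometer p ^^ i) x)"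
      by (rule phi_cong_prefix[where x = "(odometer p ^^ i) x", OF f])
  qed
  then show ?thesis
    by blast
qed

section \<open>Haar measure of cylinders and the degree of \<open>P_poly\<close>\<close>

text \<open>Used twice: small cylinders show that non-generic points are null, and positivity makes
  the top coefficient nonzero.\<close>

lemma cylinder_haar:
  assumes "p \<ge> 1" "finite J" "\<forall>k\<in>J. z k < p"
  shows "{x \<in> padic p. \<forall>k\<in>J. x k = z k} \<in> sets (haar p)"
    and "measure (haar p) {x \<in> padic p. \<forall>k\<in>J. x k = z k} = (1 / real p) ^ card J"
proof -
  have prob: "prob_space (uniform_count_measure {..<p})"
    using assms(1) by (intro prob_space_uniform_count_measure) (auto simp: lessThan_empty_iff)
  interpret product_prob_space "\<lambda>_::nat. uniform_count_measure {..<p}" UNIV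
    by (rule product_prob_spaceI) (rule prob)
  have eq: "{x \<in> padic p. \<forall>k\<in>J. x k = z k} = prod_emb UNIV (\<lambda>_. uniform_count_measure {..<p}) J (\<Pi>\<^sub>E k\<in>J. {z k})"
    by (auto simp: prod_emb_def padic_def space_uniform_count_measure PiE_def Pi_iff)
  show "{x \<in> padic p. \<forall>k\<in>J. x k = z k} \<in> sets (haar p)"
    unfolding eq haar_def using assms
    by (intro sets_PiM_I) (auto simp: sets_uniform_count_measure)
  show "measure (haar p) {x \<in> padic p. \<forall>k\<in>J. x k = z k} = (1 / real p) ^ card J"
    unfolding eq haar_def using assms
    by (subst measure_PiM_emb) (auto simp: sets_uniform_count_measure measure_uniform_count_measure)
qed

text \<open>For fixed \<open>K\<close>, the points with all digits from \<open>K\<close> on equal to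
  \<open>p - 1\<close> lie in cylinders of measure \<open>(1 / p) ^ n\<close> for every
  \<open>n\<close>; countably many \<open>K\<close> remain.\<close>

lemma AE_padic_generic:
  assumes "p \<ge> 2"
  shows "AE x in haar p. x \<in> padic_generic p"
proof -
  interpret prob_space "haar p" using assms by (intro prob_space_haar) simp
  have "AE x in haar p. \<exists>k\<ge>K. x k \<noteq> p - 1" for K
  proof -
    define C where "C n = {x \<in> padic p. \<forall>k\<in>{K..<K + n}. x k = p - 1}" for n
    define N where "N = (\<Inter>n. C n)"
    have C: "C n \<in> sets (haar p)" "measure (haar p) (C n) = (1 / real p) ^ n" for n
      using cylinder_haar[of p "{K..<K + n}" "\<lambda>_. p - 1"] assms unfolding C_def by simp_all
    have N: "N \<in> sets (haar p)"
      unfolding N_def by (rule sets.countable_INT) (use C(1) in auto)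
    have "measure (haar p) N \<le> measure (haar p) (C n)" for n
      by (rule finite_measure_mono[OF _ C(1)]) (auto simp: N_def)
    then have "measure (haar p) N \<le> (1 / real p) ^ n" for n
      by (simp only: C(2))
    moreover have "(\<lambda>n. (1 / real p) ^ n) \<longlonglongrightarrow> 0"
      using assms by (intro LIMSEQ_realpow_zero) auto
    ultimately have "measure (haar p) N \<le> 0"
      by (intro LIMSEQ_le_const) blast+
    then have "N \<in> null_sets (haar p)"
      using N by (simp add: null_sets_def emeasure_eq_measure measure_le_0_iff)
    moreover have "{x \<in> space (haar p). \<not> (\<exists>k\<ge>K. x k \<noteq> p - 1)} \<subseteq> N"
      unfolding space_haar N_def C_def by auto
    ultimately show ?thesis
      by (rule AE_I')
  qed
  then have "AE x in haar p. \<forall>K. \<exists>k\<ge>K. x k \<noteq> p - 1"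
    unfolding AE_all_countable by blast
  then show ?thesis
    using AE_space by eventually_elim (simp add: padic_generic_def space_haar INFM_nat_le)
qed

text \<open>Coefficients above \<open>S_hat_sum p m\<close> are measures of sets of non-generic
  points. The coefficient at \<open>S_hat_sum p m\<close> is at least the measure of a cylinder
  around a maximiser.\<close>

lemma P_deg_eq:
  assumes "p \<ge> 2"
  shows "P_deg p m = S_hat_sum p m"
proof -
  interpret prob_space "haar p" using assms by (intro prob_space_haar) simp
  let ?A = "\<lambda>j. {x \<in> padic p. phi_sum p m x = j}"
  have A: "?A j \<in> sets (haar p)" for j
    using measurable_sets[OF measurable_phi_sum[of p m], of "{j}"] assms
    by (simp add: space_haar vimage_def Int_def conj_commute)
  have coeff: "coeff (P_poly p m) j = (if j \<le> m * (p - 1) then measure (haar p) (?A j) else 0)" for j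
    by (simp add: P_poly_def coeff_sum)
  have "measure (haar p) (?A j) = 0" if "j > S_hat_sum p m" for j
  proof -
    have "AE x in haar p. x \<notin> ?A j"
      using AE_padic_generic[OF assms]
      by eventually_elim (use phi_sum_le_S_hat_sum[OF assms, of _ m] that in fastforce)
    then show ?thesis
      using A by (simp add: AE_iff_measurable[OF A] prob_eq_0)
  qed
  then have upper: "degree (P_poly p m) \<le> S_hat_sum p m"
    by (intro degree_le) (simp add: coeff)
  obtain x where x: "x \<in> padic_generic p" "phi_sum p m x = S_hat_sum p m"
    using phi_sum_attains_S_hat_sum[OF assms] by blast
  obtain N where N: "\<forall>y \<in> padic p. (\<forall>k<N. y k = x k) \<longrightarrow> phi_sum p m y = phi_sum p m x"
    using phi_sum_locally_constant[OF x(1) assms] by blast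
  have "0 < (1 / real p) ^ card {..<N}"
    using assms by simp
  also have "\<dots> = measure (haar p) {y \<in> padic p. \<forall>k\<in>{..<N}. y k = x k}"
    using cylinder_haar(2)[of p "{..<N}" x] padic_genericD(1)[OF x(1)] assms by (simp add: padic_def)
  also have "\<dots> \<le> measure (haar p) (?A (S_hat_sum p m))"
    using N x(2) A by (intro finite_measure_mono) auto
  \<comment> \<open>The bound on \<open>phi_sum\<close> keeps this index within the range of
    summation of \<open>P_poly\<close>.\<close>
  finally have "coeff (P_poly p m) (S_hat_sum p m) \<noteq> 0"
    using phi_sum_le[OF _ padic_genericD(1)[OF x(1)], of m] assms x(2) by (simp add: coeff)
  then have "S_hat_sum p m \<le> degree (P_poly p m)"
    by (rule le_degree)
  with upper show ?thesis
    unfolding P_deg_def by (rule le_antisym)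
qed

theorem theorem5p1:
  fixes p :: nat
  assumes "p \<ge> 3"
  shows "\<forall>j. S_seq p j = int (S_hat p j)"
  using assms by (simp add: S_seq_def P_deg_eq)

end
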